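(* Let $G$ be an abelian group, written additively, and let $F$ be a self-indulgent downward directed family of subsets of $G$. Then the finest group topology on $G$ under which $F$ converges to $0$ is Hausdorff if and only if $$\bigcup_{n>0}\ \bigcap_{S\in F} n\,S^*\ =\ \{0\},$$ in other words, if and only if for every $g\in G\setminus\{0\}$ and every integer $n>0$ there exists $S\in F$ with $g\notin n\,S^*$. In particular, for any infinite subset $X\subseteq G$ and any regular infinite cardinal $\kappa\le\mathrm{card}(X)$, the co-$\kappa$ filter on $X$ is such a (self-indulgent, downward directed) family $F$.
   Context: A family $F$ of subsets of $G$ is downward directed if it is nonempty and for all $S_1,S_2\in F$ there is $S_3\in F$ with $S_3\subseteq S_1\cap S_2$. Such families are ordered by inclusion. A subset $F'\subseteq F$ is downward cofinal in $F$ if every member of $F$ contains a member of $F'$. A group topology on $G$ is a (not necessarily Hausdorff) topology under which the group operation and inversion are continuous. $F$ converges to $x\in G$ under a topology $\mathcal{T}$ if every $\mathcal{T}$-neighborhood of $x$ contains a member of $F$. For every downward directed family $F$ there exists a finest group topology on $G$ under which $F$ converges to $0$. For $S\subseteq G$, $S^*=S\cup\{0\}\cup(-S)$, and $n\,S^*$ is the $n$-fold sumset $S^*+\dots+S^*$. Strong convergence: if $(x_i)_{i\in I}$ is a family of elements of $G$ indexed by a downward directed partially ordered set $I$, then $(x_i)_{i\in I}$ converges strongly to $x\in G$ with respect to $F$ if for every $S\in F$ there exists $i\in I$ such that for all $j\le i$ in $I$, $x_j-x\in S^*$. Self-indulgent: a downward directed family $F$ of subsets of $G$ is self-indulgent if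 for every $S\in F$ and every family $(x_T)_{T\in F'}$ of elements of $S^*$ indexed by a downward cofinal subset $F'\subseteq F$, there exist $x\in S^*$ and a downward cofinal subset $F''\subseteq F'$ such that $(x_T)_{T\in F''}$ (indexed by $F''$ ordered by inclusion) converges strongly to $x$ with respect to $F$. For an infinite set $X$ and an infinite cardinal $\kappa\le\mathrm{card}(X)$, the co-$\kappa$ filter on $X$ is the set of complements in $X$ of subsets of $X$ of cardinality $<\kappa$. *)

theory Defs
  imports "HOL-Analysis.Analysis"
begin

unbundle cardinal_syntax

section \<open>Downward directed families\<close>

definition downward_directed :: "'a set set \<Rightarrow> bool" where
  "downward_directed F \<longleftrightarrow>
     F \<noteq> {} \<and> (\<forall>S1\<in>F. \<forall>S2\<in>F. \<exists>S3\<in>F. S3 \<subseteq> S1 \<inter> S2)"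

definition downward_cofinal :: "'a set set \<Rightarrow> 'a set set \<Rightarrow> bool" where
  "downward_cofinal F' F \<longleftrightarrow> F' \<subseteq> F \<and> (\<forall>S\<in>F. \<exists>T\<in>F'. T \<subseteq> S)"

section \<open>Group topologies\<close>

definition group_topology :: "'a::ab_group_add topology \<Rightarrow> bool" where
  "group_topology \<T> \<longleftrightarrow>
     topspace \<T> = UNIV \<and>
     continuous_map (prod_topology \<T> \<T>) \<T> (\<lambda>(x, y). x + y) \<and>
     continuous_map \<T> \<T> uminus"

definition family_converges :: "'a topology \<Rightarrow> 'a set set \<Rightarrow> 'a \<Rightarrow> bool" where
  "family_converges \<T> F x \<longleftrightarrow>
     (\<forall>N. (\<exists>U. openin \<T> U \<and> x \<in> U \<and> U \<subseteq> N) \<longrightarrow> (\<exists>S\<in>F. S \<subseteq> N))"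

definition is_finest_group_topology ::
    "'a::ab_group_add set set \<Rightarrow> 'a topology \<Rightarrow> bool" where
  "is_finest_group_topology F \<T> \<longleftrightarrow>
     group_topology \<T> \<and> family_converges \<T> F 0 \<and>
     (\<forall>\<T>'. group_topology \<T>' \<and> family_converges \<T>' F 0 \<longrightarrow>
        (\<forall>U. openin \<T>' U \<longrightarrow> openin \<T> U))"

text \<open>Existence and uniqueness for downward directed \<open>F\<close> are proved in
  \<open>is_finest_group_topology_finest\<close> and \<open>is_finest_group_topology_unique\<close>.\<close>

definition finest_group_topology :: "'a::ab_group_add set set \<Rightarrow> 'a topology" where
  "finest_group_topology F = (THE \<T>. is_finest_group_topology F \<T>)"

lemma is_finest_group_topology_unique:
  assumes "is_finest_group_topology F \<T>" "is_finest_group_topology F \<T>'"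
  shows "\<T> = \<T>'"
  using assms unfolding is_finest_group_topology_def topology_eq by blast

lemma is_finest_group_topology_exists:
  fixes F :: "'a::ab_group_add set set"
  assumes F: "downward_directed F"
  shows "\<exists>\<T>. is_finest_group_topology F \<T>"
proof -
  define C where
    "C = {\<T>::'a topology. group_topology \<T> \<and> family_converges \<T> F 0}"
  define B where "B = {U. \<exists>\<T>\<in>C. openin \<T> U}"
  define T where "T = topology_generated_by B"
  have finer: "openin T U" if "\<T> \<in> C" "openin \<T> U" for \<T> U
    unfolding T_def by (rule topology_generated_by_Basis) (use that in \<open>auto simp: B_def\<close>)
  define I :: "'a topology" where "I = topology (\<lambda>U. U = {} \<or> U = UNIV)"
  have "istopology (\<lambda>U::'a set. U = {} \<or> U = UNIV)"
    unfolding istopology_def by blast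
  then have openI: "openin I U \<longleftrightarrow> U = {} \<or> U = UNIV" for U
    by (simp add: I_def topology_inverse')
  have topI: "topspace I = UNIV"
    unfolding topspace_def openI by blast
  have "openin (prod_topology I I) UNIV"
    using openin_topspace[of "prod_topology I I"] by (simp add: topI)
  then have "group_topology I"
    unfolding group_topology_def continuous_map_def openI topI
    by (auto simp: topI openI)
  moreover have "family_converges I F 0"
  proof -
    have "F \<noteq> {}" using F by (simp add: downward_directed_def)
    then show ?thesis unfolding family_converges_def openI by auto
  qed
  ultimately have "I \<in> C" by (simp add: C_def)
  then have "UNIV \<in> B" using openI by (auto simp: B_def)
  then have UB: "\<Union>B = UNIV" by blast
  then have topT: "topspace T = UNIV" by (simp add: T_def)
  have "continuous_map (prod_topology T T) T (\<lambda>(x, y). x + y)"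
    unfolding T_def
  proof (rule continuous_on_generated_topo, fold T_def)
    fix U assume "U \<in> B"
    then obtain \<T> where \<T>: "\<T> \<in> C" "openin \<T> U" by (auto simp: B_def)
    then have gt: "topspace \<T> = UNIV"
      "continuous_map (prod_topology \<T> \<T>) \<T> (\<lambda>(x, y). x + y)"
      by (auto simp: C_def group_topology_def)
    have "openin (prod_topology \<T> \<T>) ((\<lambda>(x, y). x + y) -` U)"
      using openin_continuous_map_preimage[OF gt(2) \<T>(2)] gt(1)
      by (simp add: vimage_def)
    then have "openin (prod_topology T T) ((\<lambda>(x, y). x + y) -` U)"
      unfolding openin_prod_topology_alt
      by (elim all_forward imp_forward ex_forward conj_forward)
        (auto intro: finer[OF \<T>(1)])
    then show "openin (prod_topology T T)
        ((\<lambda>(x, y). x + y) -` U \<inter> topspace (prod_topology T T))"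
      by (simp add: topT)
  qed (simp add: UB)
  moreover have "continuous_map T T uminus"
    unfolding T_def
  proof (rule continuous_on_generated_topo, fold T_def)
    fix U assume "U \<in> B"
    then obtain \<T> where \<T>: "\<T> \<in> C" "openin \<T> U" by (auto simp: B_def)
    then have gt: "topspace \<T> = UNIV" "continuous_map \<T> \<T> uminus"
      by (auto simp: C_def group_topology_def)
    have "openin \<T> (uminus -` U)"
      using openin_continuous_map_preimage[OF gt(2) \<T>(2)] gt(1)
      by (simp add: vimage_def)
    then show "openin T (uminus -` U \<inter> topspace T)"
      using finer[OF \<T>(1)] by (simp add: topT)
  qed (simp add: UB)
  ultimately have "group_topology T" using topT by (simp add: group_topology_def)
  moreover have "family_converges T F 0"
  proof -
    have "0 \<in> U \<longrightarrow> (\<exists>S\<in>F. S \<subseteq> U)" if "generate_topology_on B U" for U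
      using that
    proof (induction rule: generate_topology_on.induct)
      case (Int a b)
      show ?case
      proof
        assume "0 \<in> a \<inter> b"
        then obtain S1 S2 where "S1 \<in> F" "S1 \<subseteq> a" "S2 \<in> F" "S2 \<subseteq> b"
          using Int.IH by auto
        moreover from this F obtain S3 where "S3 \<in> F" "S3 \<subseteq> S1 \<inter> S2"
          unfolding downward_directed_def by blast
        ultimately show "\<exists>S\<in>F. S \<subseteq> a \<inter> b" by blast
      qed
    next
      case (UN K)
      then show ?case by (meson Union_iff Union_upper order_trans)
    next
      case (Basis s)
      then obtain \<T> where "openin \<T> s" "family_converges \<T> F 0"
        by (auto simp: B_def C_def)
      then show ?case unfolding family_converges_def by (meson order_refl)
    qed simp
    then show ?thesis
      unfolding family_converges_def T_def openin_topology_generated_by_iff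
      by (meson order_trans)
  qed
  ultimately have "is_finest_group_topology F T"
    unfolding is_finest_group_topology_def using finer by (auto simp: C_def)
  then show ?thesis by blast
qed

lemma is_finest_group_topology_finest:
  assumes "downward_directed F"
  shows "is_finest_group_topology F (finest_group_topology F)"
  unfolding finest_group_topology_def
proof -
  from is_finest_group_topology_exists[OF assms]
  obtain \<T> where \<T>: "is_finest_group_topology F \<T>" ..
  show "is_finest_group_topology F (THE \<T>. is_finest_group_topology F \<T>)"
    by (rule theI) (use \<T> is_finest_group_topology_unique in auto)
qed

section \<open>Symmetrisation and sumsets\<close>

text \<open>The unary minus of type \<open>'a set\<close> is the complement; hence the image under
  \<open>uminus\<close>.\<close>

definition symm :: "'a::ab_group_add set \<Rightarrow> 'a set" where
  "symm S = S \<union> {0} \<union> uminus ` S"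

text \<open>The sum is taken in the monoid of sets under elementwise addition.\<close>

definition nfold_sumset :: "nat \<Rightarrow> 'a::ab_group_add set \<Rightarrow> 'a set" where
  "nfold_sumset n A = (\<Sum>i<n. A)"

section \<open>Strong convergence and self-indulgent families\<close>

text \<open>Intended for downward directed index sets \<open>I\<close>. For an index type \<open>'a set\<close>, the
  order \<open>\<le>\<close> is inclusion; a downward cofinal subset of a downward directed family is
  again downward directed.\<close>

definition converges_strongly ::
    "'a::ab_group_add set set \<Rightarrow> 'i::order set \<Rightarrow> ('i \<Rightarrow> 'a) \<Rightarrow> 'a \<Rightarrow> bool" where
  "converges_strongly F I x l \<longleftrightarrow>
     (\<forall>S\<in>F. \<exists>i\<in>I. \<forall>j\<in>I. j \<le> i \<longrightarrow> x j - l \<in> symm S)"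

definition self_indulgent :: "'a::ab_group_add set set \<Rightarrow> bool" where
  "self_indulgent F \<longleftrightarrow>
     downward_directed F \<and>
     (\<forall>S\<in>F. \<forall>F' x. downward_cofinal F' F \<and> (\<forall>T\<in>F'. x T \<in> symm S) \<longrightarrow>
        (\<exists>l\<in>symm S. \<exists>F''. downward_cofinal F'' F' \<and> converges_strongly F F'' x l))"

section \<open>Co-\<open>\<kappa>\<close> filters\<close>

text \<open>A cardinal \<open>\<kappa>\<close> is a relation \<open>\<kappa>\<close> with \<open>Card_order \<kappa>\<close>.\<close>

definition co_card_filter :: "'k rel \<Rightarrow> 'a set \<Rightarrow> 'a set set" where
  "co_card_filter \<kappa> X = {X - Y | Y. Y \<subseteq> X \<and> |Y| <o \<kappa>}"

end

theory Submission
  imports Defs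
begin

text \<open>
  Write \<open>S*\<close> for \<open>symm S\<close> and \<open>m S*\<close> for its \<open>m\<close>-fold sumset. A group topology under which
  \<open>F\<close> converges to \<open>0\<close> has, inside any neighbourhood of \<open>0\<close> and for any fixed \<open>m\<close>, some
  \<open>m S*\<close> with \<open>S\<close> in \<open>F\<close> (\<open>nfold_sumset_small\<close>). So an element that, for some \<open>m\<close>, lies in
  \<open>m S*\<close> for all \<open>S\<close> in \<open>F\<close> cannot be separated from \<open>0\<close>, which makes the algebraic condition necessary.

  For sufficiency, the infinite sumsets \<open>\<Union>n. S\<^sub>0* + \<dots> + S\<^sub>n\<^sub>-\<^sub>1*\<close>, over all sequences in \<open>F\<close>, are
  neighbourhoods of \<open>0\<close> in the finest topology
  (\<open>finest_group_topology_sumset_neighbourhood\<close>). Given \<open>g \<noteq> 0\<close>, it is therefore enough to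
  choose the \<open>S\<^sub>i\<close> one at a time so that no partial sumset \<open>A\<close> ever contains \<open>g\<close>. The choice can
  be continued if \<open>A = \<Inter>T\<in>F. A + T*\<close>, for then \<open>g\<close> already avoids \<open>A + T*\<close> for some \<open>T\<close>.
  The property that propagates is the stronger one that \<open>\<Inter>T\<in>F. A + m T*\<close> lies in \<open>A\<close> for every \<open>m\<close>.
  For \<open>A = {0}\<close> this is the algebraic condition. It passes from \<open>A\<close> to \<open>A + S*\<close>
  (\<open>sumset_closed_add_symm\<close>) because self-indulgence works like sequential compactness:
  if \<open>g \<in> A + s\<^sub>T + m T*\<close> for every \<open>T\<close>, with \<open>s\<^sub>T\<close> in \<open>S*\<close>, then along a cofinal subfamily
  the \<open>s\<^sub>T\<close> converge strongly to some \<open>l\<close> in \<open>S*\<close>. Replacing \<open>s\<^sub>T\<close> by \<open>l\<close> costs one more summand,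
  so \<open>g - l \<in> A + (m + 1) R*\<close> for every \<open>R\<close>, and hence \<open>g - l \<in> A\<close>.

  A co-\<open>\<kappa>\<close> filter is self-indulgent because a family of points either takes one value
  cofinally often, and then has a constant cofinal subfamily, or eventually leaves every
  single point. In the second case, regularity of \<open>\<kappa>\<close> shows that it eventually leaves
  every set of fewer than \<open>\<kappa>\<close> points, which is strong convergence to \<open>0\<close>.
\<close>

section \<open>Sumsets of symmetrised sets\<close>

lemma zero_in_symm: "0 \<in> symm S"
  by (simp add: symm_def)

lemma subset_symm: "S \<subseteq> symm S"
  by (auto simp: symm_def)

lemma uminus_in_symm: "x \<in> symm S \<Longrightarrow> - x \<in> symm S"
  by (auto simp: symm_def)

lemma symm_mono: "S \<subseteq> T \<Longrightarrow> symm S \<subseteq> symm T"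
  by (auto simp: symm_def)

lemma nfold_sumset_0: "nfold_sumset 0 A = {0}"
  by (simp add: nfold_sumset_def set_zero)

lemma nfold_sumset_Suc: "nfold_sumset (Suc n) A = nfold_sumset n A + A"
  by (simp add: nfold_sumset_def)

lemma nfold_sumset_mono: "A \<subseteq> B \<Longrightarrow> nfold_sumset n A \<subseteq> nfold_sumset n B"
  by (induction n) (simp_all add: nfold_sumset_0 nfold_sumset_Suc set_plus_mono2)

lemma zero_in_nfold_sumset: "0 \<in> A \<Longrightarrow> 0 \<in> nfold_sumset n A"
proof (induction n)
  case (Suc n)
  then show ?case
    using set_plus_intro[of 0 "nfold_sumset n A" 0 A] by (simp add: nfold_sumset_Suc)
qed (simp add: nfold_sumset_0)

definition partial_sumset :: "(nat \<Rightarrow> 'a::ab_group_add set) \<Rightarrow> nat \<Rightarrow> 'a set" where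
  "partial_sumset S n = (\<Sum>i<n. symm (S i))"

lemma partial_sumset_0: "partial_sumset S 0 = {0}"
  by (simp add: partial_sumset_def set_zero)

lemma partial_sumset_Suc: "partial_sumset S (Suc n) = partial_sumset S n + symm (S n)"
  by (simp add: partial_sumset_def)

lemma partial_sumset_incseq: "incseq (partial_sumset S)"
proof (rule incseq_SucI)
  fix n
  show "partial_sumset S n \<subseteq> partial_sumset S (Suc n)"
  proof
    fix x assume "x \<in> partial_sumset S n"
    from set_plus_intro[OF this zero_in_symm[of "S n"]]
    show "x \<in> partial_sumset S (Suc n)" by (simp add: partial_sumset_Suc)
  qed
qed

lemma uminus_in_partial_sumset:
  "x \<in> partial_sumset S n \<Longrightarrow> - x \<in> partial_sumset S n"
proof (induction n arbitrary: x)
  case (Suc n)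
  from Suc.prems obtain a b where ab: "x = a + b" "a \<in> partial_sumset S n" "b \<in> symm (S n)"
    unfolding partial_sumset_Suc by (rule set_plus_elim)
  then have "- x = - a + - b" by simp
  then show ?case
    unfolding partial_sumset_Suc
    using set_plus_intro[OF Suc.IH[OF ab(2)] uminus_in_symm[OF ab(3)]] by metis
qed (simp add: partial_sumset_0)

lemma partial_sumset_mono:
  assumes "\<And>i. S i \<subseteq> T i"
  shows "partial_sumset S n \<subseteq> partial_sumset T n"
  by (induction n)
    (simp_all add: partial_sumset_0 partial_sumset_Suc set_plus_mono2 symm_mono assms)

text \<open>The triangle inequality for the infinite sumsets: the \<open>i\<close>-th summands of two elements are put
  into positions \<open>2 i\<close> and \<open>2 i + 1\<close> of the longer sum.\<close>

lemma partial_sumset_double: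
  assumes "\<And>i. T i \<subseteq> S (2 * i) \<inter> S (2 * i + 1)"
  shows "partial_sumset T n + partial_sumset T n \<subseteq> partial_sumset S (2 * n)"
proof (induction n)
  case (Suc n)
  have "symm (T n) \<subseteq> symm (S (2 * n))" "symm (T n) \<subseteq> symm (S (Suc (2 * n)))"
    using assms[of n] by (auto intro!: symm_mono)
  then have "(partial_sumset T n + partial_sumset T n) + (symm (T n) + symm (T n))
      \<subseteq> partial_sumset S (2 * n) + (symm (S (2 * n)) + symm (S (Suc (2 * n))))"
    by (intro set_plus_mono2 Suc.IH)
  then show ?case by (simp add: partial_sumset_Suc ac_simps)
qed (simp add: partial_sumset_0 set_plus_def)

section \<open>Group topologies and neighbourhoods of zero\<close>

text \<open>The classical description of a group topology by a base at \<open>0\<close>. Members of the base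
  need not be open. The halving condition makes the set of points having a translated base
  member inside \<open>N\<close> an open set, so this set is the interior of \<open>N\<close>.\<close>

lemma group_topology_from_zero_base:
  fixes \<U> :: "'a::ab_group_add set set"
  assumes dir: "downward_directed \<U>"
    and zero: "\<And>U. U \<in> \<U> \<Longrightarrow> 0 \<in> U"
    and sym: "\<And>U u. U \<in> \<U> \<Longrightarrow> u \<in> U \<Longrightarrow> - u \<in> U"
    and half: "\<And>U. U \<in> \<U> \<Longrightarrow> \<exists>V\<in>\<U>. V + V \<subseteq> U"
  obtains T where "group_topology T"
    and "\<And>N. (\<exists>W. openin T W \<and> 0 \<in> W \<and> W \<subseteq> N) \<longleftrightarrow> (\<exists>U\<in>\<U>. U \<subseteq> N)"
proof -
  define core where "core N = {x. \<exists>U\<in>\<U>. \<forall>u\<in>U. x + u \<in> N}" for N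
  define T where "T = topology (\<lambda>N. N \<subseteq> core N)"
  have mono: "core M \<subseteq> core N" if "M \<subseteq> N" for M N
    using that unfolding core_def by blast
  have inter: "core M \<inter> core N \<subseteq> core (M \<inter> N)" for M N
  proof
    fix x assume "x \<in> core M \<inter> core N"
    then obtain U V where "U \<in> \<U>" "\<forall>u\<in>U. x + u \<in> M" "V \<in> \<U>" "\<forall>u\<in>V. x + u \<in> N"
      by (auto simp: core_def)
    moreover from this obtain W where "W \<in> \<U>" "W \<subseteq> U \<inter> V"
      using dir unfolding downward_directed_def by blast
    ultimately show "x \<in> core (M \<inter> N)" unfolding core_def by blast
  qed
  have "istopology (\<lambda>N. N \<subseteq> core N)"
    unfolding istopology_def
  proof (intro conjI allI impI)
    fix M N assume "M \<subseteq> core M" "N \<subseteq> core N"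
    then show "M \<inter> N \<subseteq> core (M \<inter> N)" using inter[of M N] by blast
  next
    fix \<K> assume K: "\<forall>K\<in>\<K>. K \<subseteq> core K"
    show "\<Union>\<K> \<subseteq> core (\<Union>\<K>)"
    proof
      fix x assume "x \<in> \<Union>\<K>"
      then obtain K where "K \<in> \<K>" "x \<in> K" by blast
      then show "x \<in> core (\<Union>\<K>)" using K mono[of K "\<Union>\<K>"] by blast
    qed
  qed
  then have openT: "openin T N \<longleftrightarrow> N \<subseteq> core N" for N
    by (simp add: T_def topology_inverse')
  have sub: "core N \<subseteq> N" for N
    using zero unfolding core_def by force
  have open_int: "openin T (core N)" for N
    unfolding openT
  proof
    fix x assume "x \<in> core N"
    then obtain U where U: "U \<in> \<U>" "\<forall>u\<in>U. x + u \<in> N" by (auto simp: core_def)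
    obtain V where V: "V \<in> \<U>" "V + V \<subseteq> U" using half[OF U(1)] by blast
    have "x + v + w \<in> N" if "v \<in> V" "w \<in> V" for v w
    proof -
      have "v + w \<in> U" using V(2) set_plus_intro[OF that] by blast
      then show ?thesis using U(2) by (simp add: add.assoc)
    qed
    then show "x \<in> core (core N)"
      using V(1) unfolding core_def by blast
  qed
  have "\<U> \<noteq> {}" using dir by (simp add: downward_directed_def)
  then have "openin T UNIV" unfolding openT core_def by auto
  then have top: "topspace T = UNIV" by (simp add: openin_subset top.extremum_uniqueI)
  have add: "continuous_map (prod_topology T T) T (\<lambda>(x, y). x + y)"
    unfolding continuous_map_def
  proof (intro conjI allI impI)
    fix N assume N: "openin T N"
    have "\<exists>A B. openin T A \<and> openin T B \<and> a \<in> A \<and> b \<in> B \<and>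
            A \<times> B \<subseteq> {p. fst p + snd p \<in> N}" if ab: "a + b \<in> N" for a b
    proof -
      obtain U where U: "U \<in> \<U>" "\<forall>u\<in>U. a + b + u \<in> N"
        using N ab unfolding openT core_def by blast
      obtain V where V: "V \<in> \<U>" "V + V \<subseteq> U" using half[OF U(1)] by blast
      define nb where "nb c = core ((\<lambda>v. c + v) ` V)" for c
      have "c \<in> nb c" for c using V(1) unfolding nb_def core_def by blast
      moreover have "openin T (nb c)" for c unfolding nb_def by (rule open_int)
      moreover have "x + y \<in> N" if "x \<in> nb a" "y \<in> nb b" for x y
      proof -
        from that sub obtain v w where vw: "v \<in> V" "w \<in> V" "x = a + v" "y = b + w"
          unfolding nb_def by blast
        then have "v + w \<in> U" using V(2) set_plus_intro by blast
        then have "a + b + (v + w) \<in> N" using U(2) by blast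
        then show ?thesis using vw by (simp add: algebra_simps)
      qed
      ultimately show ?thesis by (intro exI[of _ "nb a"] exI[of _ "nb b"]) auto
    qed
    then show "openin (prod_topology T T)
        {p \<in> topspace (prod_topology T T). (case p of (x, y) \<Rightarrow> x + y) \<in> N}"
      by (simp add: openin_prod_topology_alt top case_prod_beta)
  qed (simp add: top)
  have "continuous_map T T uminus"
    unfolding continuous_map_def
  proof (intro conjI allI impI)
    fix N assume N: "openin T N"
    have "x \<in> core {x. - x \<in> N}" if x: "- x \<in> N" for x
    proof -
      obtain U where U: "U \<in> \<U>" "\<forall>u\<in>U. - x + u \<in> N"
        using N x unfolding openT core_def by blast
      have "- (x + u) \<in> N" if "u \<in> U" for u
        using U(2) sym[OF U(1) that] by (metis minus_add_distrib)
      then show ?thesis using U(1) unfolding core_def by blast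
    qed
    then show "openin T {x \<in> topspace T. - x \<in> N}" unfolding openT top by auto
  qed (simp add: top)
  with top add have "group_topology T" by (simp add: group_topology_def)
  moreover have "(\<exists>W. openin T W \<and> 0 \<in> W \<and> W \<subseteq> N) \<longleftrightarrow> (\<exists>U\<in>\<U>. U \<subseteq> N)" for N
  proof
    assume "\<exists>W. openin T W \<and> 0 \<in> W \<and> W \<subseteq> N"
    then obtain W where "W \<subseteq> N" "0 \<in> core W" unfolding openT by blast
    then show "\<exists>U\<in>\<U>. U \<subseteq> N" unfolding core_def by auto
  next
    assume "\<exists>U\<in>\<U>. U \<subseteq> N"
    then have "0 \<in> core N" unfolding core_def by auto
    then show "\<exists>W. openin T W \<and> 0 \<in> W \<and> W \<subseteq> N" using open_int sub by blast
  qed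
  ultimately show thesis by (rule that)
qed

text \<open>Continuity of addition at \<open>(0, 0)\<close> and of negation at \<open>0\<close>, in the form in which it is used.\<close>

lemma group_topology_halving:
  assumes T: "group_topology T" and U: "openin T U" "0 \<in> U"
  obtains V where "openin T V" "0 \<in> V" "V + V \<subseteq> U" "\<And>v. v \<in> V \<Longrightarrow> - v \<in> V"
proof -
  have top: "topspace T = UNIV" using T by (simp add: group_topology_def)
  have "openin (prod_topology T T) {p. fst p + snd p \<in> U}"
    using openin_continuous_map_preimage[OF _ U(1), of "prod_topology T T" "\<lambda>(x, y). x + y"] T top
    by (simp add: group_topology_def case_prod_beta)
  moreover have "(0, 0) \<in> {p. fst p + snd p \<in> U}" using U(2) by simp
  ultimately obtain A B where AB: "openin T A" "openin T B" "0 \<in> A" "0 \<in> B"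
      "A \<times> B \<subseteq> {p. fst p + snd p \<in> U}"
    unfolding openin_prod_topology_alt by (elim allE impE) blast+
  define C where "C = A \<inter> B"
  have C: "openin T C" "0 \<in> C" using AB by (auto simp: C_def)
  then have "openin T {x. - x \<in> C}"
    using T openin_continuous_map_preimage[OF _ C(1), of T uminus]
    by (simp add: group_topology_def)
  then have "openin T (C \<inter> {x. - x \<in> C})" using C by blast
  moreover have "(C \<inter> {x. - x \<in> C}) + (C \<inter> {x. - x \<in> C}) \<subseteq> U"
    using AB(5) by (auto simp: C_def elim!: set_plus_elim)
  ultimately show thesis using that[of "C \<inter> {x. - x \<in> C}"] C by simp
qed

text \<open>By homogeneity only the pairs \<open>0, g\<close> matter. A neighbourhood of \<open>0\<close> that misses \<open>y - x\<close>
  suffices, since the translates of a symmetric half of it to \<open>x\<close> and to \<open>y\<close> are disjoint.\<close>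

lemma Hausdorff_group_topology_iff:
  assumes T: "group_topology T"
  shows "Hausdorff_space T \<longleftrightarrow> (\<forall>g. g \<noteq> 0 \<longrightarrow> (\<exists>U. openin T U \<and> 0 \<in> U \<and> g \<notin> U))"
proof
  have top: "topspace T = UNIV" using T by (simp add: group_topology_def)
  show "\<forall>g. g \<noteq> 0 \<longrightarrow> (\<exists>U. openin T U \<and> 0 \<in> U \<and> g \<notin> U)" if Hd: "Hausdorff_space T"
  proof (intro allI impI)
    fix g :: 'a assume "g \<noteq> 0"
    then obtain U V where "openin T U" "openin T V" "0 \<in> U" "g \<in> V" "disjnt U V"
      using Hd top unfolding Hausdorff_space_def by (metis UNIV_I)
    then show "\<exists>U. openin T U \<and> 0 \<in> U \<and> g \<notin> U" by (auto simp: disjnt_def)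
  qed
  assume sep: "\<forall>g. g \<noteq> 0 \<longrightarrow> (\<exists>U. openin T U \<and> 0 \<in> U \<and> g \<notin> U)"
  have translate: "openin T {a. a - x \<in> V}" if "openin T V" for V x
  proof -
    have "continuous_map T (prod_topology T T) (\<lambda>a. (a, - x))"
      by (rule continuous_map_pairedI) (simp_all add: top)
    from continuous_map_compose[OF this, of T "\<lambda>(a, b). a + b"] T
    have "continuous_map T T (\<lambda>a. a - x)"
      by (simp add: group_topology_def comp_def)
    from openin_continuous_map_preimage[OF this that] show ?thesis by (simp add: top)
  qed
  show "Hausdorff_space T"
    unfolding Hausdorff_space_def
  proof (intro allI impI)
    fix x y assume "x \<in> topspace T \<and> y \<in> topspace T \<and> x \<noteq> y"
    then have "y - x \<noteq> 0" by auto
    then obtain U where U: "openin T U" "0 \<in> U" "y - x \<notin> U" using sep by blast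
    obtain V where V: "openin T V" "0 \<in> V" "V + V \<subseteq> U" "\<And>v. v \<in> V \<Longrightarrow> - v \<in> V"
      using group_topology_halving[OF T U(1,2)] by blast
    have "disjnt {a. a - x \<in> V} {a. a - y \<in> V}"
      unfolding disjnt_iff
    proof (intro allI notI)
      fix a assume "a \<in> {a. a - x \<in> V} \<and> a \<in> {a. a - y \<in> V}"
      then have "(a - x) + - (a - y) \<in> V + V" by (intro set_plus_intro V(4)) auto
      then show False using V(3) U(3) by auto
    qed
    then show "\<exists>A B. openin T A \<and> openin T B \<and> x \<in> A \<and> y \<in> B \<and> disjnt A B"
      using V(2) translate[OF V(1)]
      by (intro exI[of _ "{a. a - x \<in> V}"] exI[of _ "{a. a - y \<in> V}"]) simp
  qed
qed

text \<open>The necessity of the algebraic condition: points in every \<open>n\<close>-fold sumset lie in every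
  neighbourhood of \<open>0\<close>. Each summand takes up half of the neighbourhood that is left.\<close>

lemma nfold_sumset_small:
  assumes F: "downward_directed F" and T: "group_topology T" and conv: "family_converges T F 0"
    and U: "openin T U" "0 \<in> U"
  shows "\<exists>S\<in>F. nfold_sumset n (symm S) \<subseteq> U"
  using U
proof (induction n arbitrary: U)
  case 0
  then show ?case using F by (auto simp: nfold_sumset_0 downward_directed_def)
next
  case (Suc n)
  obtain V where V: "openin T V" "0 \<in> V" "V + V \<subseteq> U" "\<And>v. v \<in> V \<Longrightarrow> - v \<in> V"
    using group_topology_halving[OF T Suc.prems] by blast
  obtain S1 where S1: "S1 \<in> F" "nfold_sumset n (symm S1) \<subseteq> V" using Suc.IH V by blast
  obtain S2 where S2: "S2 \<in> F" "S2 \<subseteq> V"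
    using conv V(1,2) unfolding family_converges_def by blast
  obtain S where S: "S \<in> F" "S \<subseteq> S1" "S \<subseteq> S2"
    using F S1(1) S2(1) unfolding downward_directed_def by (meson le_inf_iff)
  have "symm S \<subseteq> V" using S(3) S2(2) V(2,4) by (auto simp: symm_def)
  moreover have "nfold_sumset n (symm S) \<subseteq> V"
    using S1(2) nfold_sumset_mono[OF symm_mono[OF S(2)]] by blast
  ultimately have "nfold_sumset (Suc n) (symm S) \<subseteq> V + V"
    unfolding nfold_sumset_Suc by (rule set_plus_mono2[rotated])
  then show ?case using S(1) V(3) by blast
qed

text \<open>The infinite sumsets form a base at \<open>0\<close> of a group topology. \<open>F\<close> converges to \<open>0\<close> in it,
  because such a sumset contains the first member of its sequence. The finest topology has all
  of its open sets.\<close>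

lemma finest_group_topology_sumset_neighbourhood:
  assumes F: "downward_directed F" and S: "\<And>i. S i \<in> F"
  obtains W where "openin (finest_group_topology F) W" "0 \<in> W" "W \<subseteq> (\<Union>n. partial_sumset S n)"
proof -
  define \<U> where "\<U> = {\<Union>n. partial_sumset S n | S. \<forall>i. S i \<in> F}"
  have refine: "\<exists>R. \<forall>i. R i \<in> F \<and> R i \<subseteq> P i \<inter> Q i"
    if "\<forall>i. P i \<in> F" "\<forall>i. Q i \<in> F" for P Q :: "nat \<Rightarrow> 'a set"
    using F that unfolding downward_directed_def by (intro choice) blast
  obtain T where T: "group_topology T"
    and nb: "\<And>N. (\<exists>W. openin T W \<and> 0 \<in> W \<and> W \<subseteq> N) \<longleftrightarrow> (\<exists>U\<in>\<U>. U \<subseteq> N)"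
  proof (rule group_topology_from_zero_base[of \<U>])
    show "downward_directed \<U>"
      unfolding downward_directed_def
    proof (intro conjI ballI)
      show "\<U> \<noteq> {}" using S by (auto simp: \<U>_def)
    next
      fix U V assume "U \<in> \<U>" "V \<in> \<U>"
      then obtain P Q where PQ: "\<forall>i. P i \<in> F" "\<forall>i. Q i \<in> F"
        "U = (\<Union>n. partial_sumset P n)" "V = (\<Union>n. partial_sumset Q n)"
        by (auto simp: \<U>_def)
      obtain R where R: "\<forall>i. R i \<in> F \<and> R i \<subseteq> P i \<inter> Q i" using refine[OF PQ(1,2)] by blast
      then have "(\<Union>n. partial_sumset R n) \<in> \<U>" by (auto simp: \<U>_def)
      moreover have "(\<Union>n. partial_sumset R n) \<subseteq> U \<inter> V"
        using partial_sumset_mono[of R P] partial_sumset_mono[of R Q] R PQ(3,4) by blast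
      ultimately show "\<exists>W\<in>\<U>. W \<subseteq> U \<inter> V" by blast
    qed
  next
    fix U assume "U \<in> \<U>"
    then obtain P where P: "\<forall>i. P i \<in> F" "U = (\<Union>n. partial_sumset P n)"
      by (auto simp: \<U>_def)
    show "0 \<in> U" using partial_sumset_0[of P] P(2) by blast
    show "- u \<in> U" if "u \<in> U" for u using that uminus_in_partial_sumset P(2) by blast
    obtain R where R: "\<forall>i. R i \<in> F \<and> R i \<subseteq> P (2 * i) \<inter> P (2 * i + 1)"
      using refine[of "\<lambda>i. P (2 * i)" "\<lambda>i. P (2 * i + 1)"] P(1) by blast
    have "(\<Union>n. partial_sumset R n) + (\<Union>n. partial_sumset R n) \<subseteq> U"
    proof
      fix x assume "x \<in> (\<Union>n. partial_sumset R n) + (\<Union>n. partial_sumset R n)"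
      then obtain a b m k where ab: "x = a + b" "a \<in> partial_sumset R m" "b \<in> partial_sumset R k"
        by (auto elim!: set_plus_elim)
      have "a \<in> partial_sumset R (max m k)" "b \<in> partial_sumset R (max m k)"
        using ab(2,3) incseqD[OF partial_sumset_incseq[of R], of m "max m k"]
          incseqD[OF partial_sumset_incseq[of R], of k "max m k"] by auto
      then have "x \<in> partial_sumset P (2 * max m k)"
        using partial_sumset_double[of R P "max m k"] R ab(1) set_plus_intro by blast
      then show "x \<in> U" using P(2) by blast
    qed
    then show "\<exists>V\<in>\<U>. V + V \<subseteq> U" using R unfolding \<U>_def by blast
  qed (rule that)
  have "family_converges T F 0"
    unfolding family_converges_def nb
  proof (intro allI impI)
    fix N assume "\<exists>U\<in>\<U>. U \<subseteq> N"
    then obtain P where P: "\<forall>i. P i \<in> F" "(\<Union>n. partial_sumset P n) \<subseteq> N"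
      by (auto simp: \<U>_def)
    have "P 0 \<subseteq> partial_sumset P (Suc 0)"
      using subset_symm by (auto simp: partial_sumset_Suc partial_sumset_0 set_plus_def)
    then show "\<exists>S\<in>F. S \<subseteq> N" using P by blast
  qed
  then have finer: "openin (finest_group_topology F) W" if "openin T W" for W
    using is_finest_group_topology_finest[OF F] T that
    unfolding is_finest_group_topology_def by blast
  have "(\<Union>n. partial_sumset S n) \<in> \<U>" using S by (auto simp: \<U>_def)
  then obtain W where "openin T W" "0 \<in> W" "W \<subseteq> (\<Union>n. partial_sumset S n)"
    using nb[of "\<Union>n. partial_sumset S n"] by blast
  then show thesis using that finer by blast
qed

section \<open>Self-indulgent families\<close>

text \<open>A closure property in terms of \<open>F\<close> alone. All multiples \<open>m\<close> are allowed, not only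
  \<open>m = 1\<close>, because adding a summand \<open>symm S\<close> to \<open>A\<close> reduces the property for \<open>m\<close> to the one for
  \<open>m + 1\<close>.\<close>

definition sumset_closed :: "'a::ab_group_add set set \<Rightarrow> 'a set \<Rightarrow> bool" where
  "sumset_closed F A \<longleftrightarrow> (\<forall>m. (\<Inter>T\<in>F. A + nfold_sumset m (symm T)) \<subseteq> A)"

text \<open>The analogue of the fact that the sum of a closed set and a compact set is closed:
  self-indulgence supplies the convergent subfamily of the summands in \<open>symm S\<close>.\<close>

lemma sumset_closed_add_symm:
  assumes F: "self_indulgent F" and A: "sumset_closed F A" and S: "S \<in> F"
  shows "sumset_closed F (A + symm S)"
  unfolding sumset_closed_def
proof (intro allI subsetI)
  fix m g assume "g \<in> (\<Inter>T\<in>F. A + symm S + nfold_sumset m (symm T))"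
  then have "\<forall>T\<in>F. \<exists>s\<in>symm S. g - s \<in> A + nfold_sumset m (symm T)"
    by (fastforce elim!: set_plus_elim simp: set_plus_def algebra_simps)
  then obtain s where s: "\<And>T. T \<in> F \<Longrightarrow> s T \<in> symm S"
      "\<And>T. T \<in> F \<Longrightarrow> g - s T \<in> A + nfold_sumset m (symm T)"
    by metis
  have dir: "downward_directed F" using F by (simp add: self_indulgent_def)
  have "downward_cofinal F F" by (auto simp: downward_cofinal_def)
  then obtain l F'' where l: "l \<in> symm S" and F'': "downward_cofinal F'' F"
      and lim: "converges_strongly F F'' s l"
    using F S s(1) unfolding self_indulgent_def by blast
  have "g - l \<in> A + nfold_sumset (Suc m) (symm R)" if R: "R \<in> F" for R
  proof -
    obtain I where I: "I \<in> F''" "\<And>J. J \<in> F'' \<Longrightarrow> J \<subseteq> I \<Longrightarrow> s J - l \<in> symm R"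
      using lim R unfolding converges_strongly_def by blast
    have "I \<in> F" using I(1) F'' by (auto simp: downward_cofinal_def)
    then obtain K where K: "K \<in> F" "K \<subseteq> I \<inter> R"
      using dir R unfolding downward_directed_def by blast
    \<comment> \<open>\<open>J\<close> must lie below \<open>I\<close>, so that \<open>s J\<close> is close to \<open>l\<close>, and below \<open>R\<close>, so that the
      \<open>m\<close>-fold remainder lies in the sumset of \<open>R\<close>.\<close>
    obtain J where J': "J \<in> F''" "J \<subseteq> K"
      using F'' K(1) unfolding downward_cofinal_def by blast
    then have J: "J \<in> F''" "J \<in> F" "J \<subseteq> I" "J \<subseteq> R"
      using F'' K(2) by (auto simp: downward_cofinal_def)
    have "g - s J \<in> A + nfold_sumset m (symm R)"
      using s(2)[OF J(2)] set_plus_mono2[OF order_refl nfold_sumset_mono[OF symm_mono[OF J(4)]]]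
      by blast
    from set_plus_intro[OF this I(2)[OF J(1,3)]] show ?thesis
      by (simp add: nfold_sumset_Suc add.assoc)
  qed
  then have "g - l \<in> A" using A unfolding sumset_closed_def by blast
  from set_plus_intro[OF this l] show "g \<in> A + symm S" by simp
qed

text \<open>Starting at \<open>{0}\<close>, which is closed by the algebraic condition, a closed partial sumset that
  misses \<open>g\<close> can always be enlarged by one more summand: its closedness for \<open>m = 1\<close> provides
  the next member of the sequence.\<close>

lemma sumset_avoiding_sequence:
  assumes F: "self_indulgent F"
    and zero: "\<And>h n. h \<noteq> 0 \<Longrightarrow> n > 0 \<Longrightarrow> \<exists>S\<in>F. h \<notin> nfold_sumset n (symm S)"
    and g: "g \<noteq> 0"
  obtains S where "\<And>i. S i \<in> F" "g \<notin> (\<Union>n. partial_sumset S n)"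
proof -
  define good where "good A \<longleftrightarrow> sumset_closed F A \<and> g \<notin> A" for A
  have ne: "F \<noteq> {}" using F by (simp add: self_indulgent_def downward_directed_def)
  have "h = 0" if "\<forall>T\<in>F. h \<in> nfold_sumset m (symm T)" for m h
    using that zero[of h m] ne by (cases m) (auto simp: nfold_sumset_0)
  then have "sumset_closed F {0}" by (auto simp: sumset_closed_def set_plus_def)
  then have good0: "good {0}" using g by (simp add: good_def)
  have step: "\<exists>A'. good A' \<and> (\<exists>S\<in>F. A' = A + symm S)" if "good A" for A
  proof -
    have "g \<notin> (\<Inter>T\<in>F. A + nfold_sumset 1 (symm T))"
      using that unfolding good_def sumset_closed_def by blast
    then obtain S where "S \<in> F" "g \<notin> A + symm S"
      by (auto simp: nfold_sumset_def)
    then show ?thesis using that sumset_closed_add_symm[OF F] by (auto simp: good_def)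
  qed
  obtain B where seq: "\<forall>n. (good (B n) \<and> (n = 0 \<longrightarrow> B n = {0})) \<and>
      (\<exists>S\<in>F. B (Suc n) = B n + symm S)"
    by (rule exE[OF dependent_nat_choice[of "\<lambda>n A. good A \<and> (n = 0 \<longrightarrow> A = {0})"
        "\<lambda>n A A'. \<exists>S\<in>F. A' = A + symm S"]]) (use good0 step in simp_all)
  then have B: "good (B n)" "B 0 = {0}" for n by simp_all
  obtain S where S: "\<And>n. S n \<in> F" "\<And>n. B (Suc n) = B n + symm (S n)"
    using seq by metis
  have "B n = partial_sumset S n" for n
    by (induction n) (simp_all add: B(2) S(2) partial_sumset_0 partial_sumset_Suc)
  then show thesis using that[of S] S(1) B(1) by (simp add: good_def)
qed

lemma Hausdorff_finest_group_topology_iff: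
  assumes F: "self_indulgent F"
  shows "Hausdorff_space (finest_group_topology F) \<longleftrightarrow>
    (\<forall>g. g \<noteq> 0 \<longrightarrow> (\<forall>n>0. \<exists>S\<in>F. g \<notin> nfold_sumset n (symm S)))"
proof -
  have dir: "downward_directed F" using F by (simp add: self_indulgent_def)
  then have T: "group_topology (finest_group_topology F)"
    and conv: "family_converges (finest_group_topology F) F 0"
    using is_finest_group_topology_finest[OF dir] by (auto simp: is_finest_group_topology_def)
  show ?thesis
    unfolding Hausdorff_group_topology_iff[OF T]
  proof (intro iffI allI impI)
    fix g :: 'a and n :: nat
    assume "\<forall>g. g \<noteq> 0 \<longrightarrow> (\<exists>U. openin (finest_group_topology F) U \<and> 0 \<in> U \<and> g \<notin> U)" "g \<noteq> 0"
    then obtain U where "openin (finest_group_topology F) U" "0 \<in> U" "g \<notin> U" by blast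
    then show "\<exists>S\<in>F. g \<notin> nfold_sumset n (symm S)"
      using nfold_sumset_small[OF dir T conv, of U n] by blast
  next
    fix g :: 'a
    assume zero: "\<forall>g. g \<noteq> 0 \<longrightarrow> (\<forall>n>0. \<exists>S\<in>F. g \<notin> nfold_sumset n (symm S))" and g: "g \<noteq> 0"
    obtain S where S: "\<And>i. S i \<in> F" "g \<notin> (\<Union>n. partial_sumset S n)"
      by (rule sumset_avoiding_sequence[OF F _ g]) (use zero in auto)
    obtain U where "openin (finest_group_topology F) U" "0 \<in> U" "U \<subseteq> (\<Union>n. partial_sumset S n)"
      by (rule finest_group_topology_sumset_neighbourhood[OF dir, of S, OF S(1)])
    then show "\<exists>U. openin (finest_group_topology F) U \<and> 0 \<in> U \<and> g \<notin> U"
      using S(2) by blast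
  qed
qed

section \<open>Co-\<open>\<kappa>\<close> filters\<close>

text \<open>This is where regularity of \<open>\<kappa>\<close> enters. The factor \<open>X\<close> covers the empty intersection.\<close>

lemma co_card_filter_INT:
  assumes \<kappa>: "Cinfinite \<kappa>" "regularCard \<kappa>" and I: "|I| <o \<kappa>"
    and R: "\<And>i. i \<in> I \<Longrightarrow> R i \<in> co_card_filter \<kappa> X"
  shows "X \<inter> (\<Inter>i\<in>I. R i) \<in> co_card_filter \<kappa> X"
proof -
  obtain Y where Y: "\<And>i. i \<in> I \<Longrightarrow> R i = X - Y i \<and> Y i \<subseteq> X \<and> |Y i| <o \<kappa>"
    using R unfolding co_card_filter_def mem_Collect_eq by metis
  then have "|\<Union>i\<in>I. Y i| <o \<kappa>" by (intro regularCard_UNION_bound[OF \<kappa> I]) auto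
  moreover have "X \<inter> (\<Inter>i\<in>I. R i) = X - (\<Union>i\<in>I. Y i)" "(\<Union>i\<in>I. Y i) \<subseteq> X"
    using Y by auto
  ultimately show ?thesis unfolding co_card_filter_def by blast
qed

lemma downward_directed_co_card_filter:
  assumes \<kappa>: "Cinfinite \<kappa>"
  shows "downward_directed (co_card_filter \<kappa> X)"
  unfolding downward_directed_def
proof (intro conjI ballI)
  have "|{}| <o \<kappa>"
    by (rule Cfinite_ordLess_Cinfinite[OF _ \<kappa>])
      (simp add: cfinite_def Field_card_of card_of_card_order_on)
  then show "co_card_filter \<kappa> X \<noteq> {}" unfolding co_card_filter_def by blast
next
  fix S1 S2 assume "S1 \<in> co_card_filter \<kappa> X" "S2 \<in> co_card_filter \<kappa> X"
  then obtain Y1 Y2 where Y: "S1 = X - Y1" "S2 = X - Y2" "Y1 \<union> Y2 \<subseteq> X"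
      "|Y1| <o \<kappa>" "|Y2| <o \<kappa>"
    by (auto simp: co_card_filter_def)
  then have "X - (Y1 \<union> Y2) \<in> co_card_filter \<kappa> X"
    using Un_Cinfinite_bound_strict[OF Y(4,5) \<kappa>] unfolding co_card_filter_def by blast
  moreover have "X - (Y1 \<union> Y2) \<subseteq> S1 \<inter> S2" using Y by blast
  ultimately show "\<exists>S3\<in>co_card_filter \<kappa> X. S3 \<subseteq> S1 \<inter> S2" by blast
qed

text \<open>Either some value is taken cofinally often, and the limit is that value, or every value is
  avoided from some index on, and the family itself converges strongly to \<open>0\<close>: to end up in
  \<open>symm (X - Y)\<close> it only has to leave the fewer than \<open>\<kappa>\<close> points of \<open>Y\<close> and their negatives.\<close>

lemma self_indulgent_co_card_filter:
  fixes X :: "'a::ab_group_add set"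
  assumes \<kappa>: "Cinfinite \<kappa>" "regularCard \<kappa>"
  shows "self_indulgent (co_card_filter \<kappa> X)"
  unfolding self_indulgent_def
proof (intro conjI ballI allI impI, goal_cases)
  case 1
  show ?case by (rule downward_directed_co_card_filter[OF \<kappa>(1)])
next
  case (2 S F' x)
  define F where "F = co_card_filter \<kappa> X"
  have F': "F' \<subseteq> F" "\<And>R. R \<in> F \<Longrightarrow> \<exists>T\<in>F'. T \<subseteq> R"
    and x: "\<And>T. T \<in> F' \<Longrightarrow> x T \<in> symm S"
    using 2 by (auto simp: F_def downward_cofinal_def)
  have S: "S \<in> F" using 2 by (simp add: F_def)
  show ?case
  proof (cases "\<exists>l\<in>symm S. downward_cofinal {T \<in> F'. x T = l} F'")
    case True
    then obtain l where l: "l \<in> symm S" "downward_cofinal {T \<in> F'. x T = l} F'" by blast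
    have "converges_strongly F {T \<in> F'. x T = l} x l"
      unfolding converges_strongly_def
      using l(2) F'(2) zero_in_symm unfolding downward_cofinal_def by fastforce
    then show ?thesis using l unfolding F_def by blast
  next
    case False
    have avoid: "\<exists>R\<in>F. \<forall>T\<in>F'. T \<subseteq> R \<longrightarrow> x T \<noteq> l" for l
    proof (cases "l \<in> symm S")
      case True
      then have "\<not> downward_cofinal {T \<in> F'. x T = l} F'" using False by simp
      then obtain R where "R \<in> F'" "\<And>T. T \<in> F' \<Longrightarrow> x T = l \<Longrightarrow> \<not> T \<subseteq> R"
        by (auto simp: downward_cofinal_def)
      then show ?thesis using F'(1) by (intro bexI[of _ R]) auto
    next
      case False
      then have "\<forall>T\<in>F'. T \<subseteq> S \<longrightarrow> x T \<noteq> l" using x by auto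
      then show ?thesis using S by (rule bexI)
    qed
    then obtain R where R: "\<And>l. R l \<in> F" "\<And>l T. T \<in> F' \<Longrightarrow> T \<subseteq> R l \<Longrightarrow> x T \<noteq> l" by metis
    have "converges_strongly F F' x 0"
      unfolding converges_strongly_def
    proof
      fix Q assume "Q \<in> F"
      then obtain Y where Y: "Q = X - Y" "|Y| <o \<kappa>" by (auto simp: F_def co_card_filter_def)
      define Z where "Z = Y \<union> uminus ` Y"
      have "|Z| <o \<kappa>"
        unfolding Z_def
        by (rule Un_Cinfinite_bound_strict[OF Y(2) ordLeq_ordLess_trans[OF card_of_image Y(2)] \<kappa>(1)])
      then have "X \<inter> (\<Inter>z\<in>Z. R z) \<in> F"
        using co_card_filter_INT[OF \<kappa>] R(1) unfolding F_def by blast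
      then obtain I where I: "I \<in> F'" "I \<subseteq> (\<Inter>z\<in>Z. R z)" using F'(2) by blast
      have "x J - 0 \<in> symm Q" if J: "J \<in> F'" "J \<subseteq> I" for J
      proof -
        have notZ: "x J \<notin> Z" using R(2)[OF J(1), of "x J"] J(2) I(2) by blast
        have "S \<subseteq> X" using S by (auto simp: F_def co_card_filter_def)
        then have "x J \<in> symm X" using symm_mono x[OF J(1)] by blast
        then show ?thesis using notZ unfolding symm_def Y(1) Z_def by auto
      qed
      then show "\<exists>I\<in>F'. \<forall>J\<in>F'. J \<le> I \<longrightarrow> x J - 0 \<in> symm Q" using I(1) by blast
    qed
    moreover have "downward_cofinal F' F'" by (auto simp: downward_cofinal_def)
    ultimately show ?thesis using zero_in_symm unfolding F_def by blast
  qed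
qed

theorem theorem7:
  shows "(\<forall>F :: 'a::ab_group_add set set.
            downward_directed F \<and> self_indulgent F \<longrightarrow>
              (Hausdorff_space (finest_group_topology F) \<longleftrightarrow>
                 (\<Union>n\<in>{0<..}. \<Inter>S\<in>F. nfold_sumset n (symm S)) = {0}) \<and>
              (Hausdorff_space (finest_group_topology F) \<longleftrightarrow>
                 (\<forall>g. g \<noteq> 0 \<longrightarrow> (\<forall>n>0. \<exists>S\<in>F. g \<notin> nfold_sumset n (symm S)))))
       \<and> (\<forall>(X :: 'a set) (\<kappa> :: 'k rel).
            infinite X \<and> Card_order \<kappa> \<and> cinfinite \<kappa> \<and> regularCard \<kappa> \<and> \<kappa> \<le>o |X| \<longrightarrow>
              downward_directed (co_card_filter \<kappa> X) \<and> self_indulgent (co_card_filter \<kappa> X))"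
proof (intro conjI allI impI, goal_cases)
  case (1 F)
  define K where "K = (\<Union>n\<in>{0<..}. \<Inter>S\<in>F. nfold_sumset n (symm S))"
  have "0 \<in> K"
    using zero_in_nfold_sumset[OF zero_in_symm, of "Suc 0"] unfolding K_def by blast
  then have "K = {0} \<longleftrightarrow> (\<forall>g. g \<noteq> 0 \<longrightarrow> g \<notin> K)" by blast
  also have "\<dots> \<longleftrightarrow> (\<forall>g. g \<noteq> 0 \<longrightarrow> (\<forall>n>0. \<exists>S\<in>F. g \<notin> nfold_sumset n (symm S)))"
    by (simp add: K_def Ball_def[of "{0<..}"])
  finally show ?case
    using 1 Hausdorff_finest_group_topology_iff[of F] unfolding K_def by simp
next
  case (2 F)
  then have "self_indulgent F" by simp
  then show ?case by (rule Hausdorff_finest_group_topology_iff)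
next
  case (3 X \<kappa>)
  then have "Cinfinite \<kappa>" by simp
  then show ?case by (rule downward_directed_co_card_filter)
next
  case (4 X \<kappa>)
  then have "Cinfinite \<kappa>" "regularCard \<kappa>" by simp_all
  then show ?case by (rule self_indulgent_co_card_filter)
qed

end
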